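(* Let $n\ge1$ be an integer and let $\omega\in\mathbb{R}\setminus\{0,-1,-2,\ldots,-n\}$. Then, as polynomials in $z$, $$(\omega+n)\,\frac{d\mathcal{S}_n^\omega(z)}{dz}=nz\,\frac{d\mathcal{S}_{n-1}^\omega(z)}{dz}+n(1+\omega)\,\mathcal{S}_{n-1}^\omega(z).$$
   Context: For $n\in\{0,1,2,\ldots\}$ and real $\omega\notin\{-1,\ldots,-n\}$ the skyburst polynomial $\mathcal{S}_n^\omega$ is the monic polynomial of degree $n$ $$\mathcal{S}_n^\omega(z)=z^n\,{}_2F_1\!\left[\begin{array}{l}-n,-\omega;\\-n-\omega;\end{array}-\frac1z\right]=\sum_{\ell=0}^n\binom{n}{\ell}\frac{(-\omega)_\ell}{(-n-\omega)_\ell}\,z^{n-\ell},$$ where $(a)_\ell=a(a+1)\cdots(a+\ell-1)$, $(a)_0=1$. *)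

theory Defs
  imports Complex_Main "HOL-Computational_Algebra.Polynomial"
begin

(* Meaningful only for \<omega> not in {-1, ..., -n}; for these excluded values a denominator
   pochhammer (- real n - \<omega>) l vanishes and the library convention x / 0 = 0 applies. *)
definition skyburst :: "nat \<Rightarrow> real \<Rightarrow> real poly" where
  "skyburst n \<omega> =
     (\<Sum>l = 0..n. monom (real (n choose l) * (pochhammer (- \<omega>) l / pochhammer (- real n - \<omega>) l))
                         (n - l))"

end

theory Submission
  imports Defs
begin

text \<open>Compare coefficients of z^j, with m = n - 1 and l = m - j. The operator z d/dz
  multiplies the coefficient of z^j by j, so the right side collects the factor j + 1 + \<omega>.
  Absorption, (j+1) (n choose j+1) = n (m choose j), matches the binomials, and both sides carry the
  same numerator (-\<omega>)_l. What remains is (\<omega>+n) / (-n-\<omega>)_l = (j+1+\<omega>) /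
  (-m-\<omega>)_l, a shift of the Pochhammer base by one.\<close>

lemma coeff_skyburst:
  "coeff (skyburst n \<omega>) k =
     real (n choose k) * (pochhammer (- \<omega>) (n - k) / pochhammer (- real n - \<omega>) (n - k))"
proof (cases "k \<le> n")
  case True
  have "coeff (skyburst n \<omega>) k =
      (\<Sum>l = 0..n. if l = n - k
         then real (n choose l) * (pochhammer (- \<omega>) l / pochhammer (- real n - \<omega>) l) else 0)"
    unfolding skyburst_def coeff_sum coeff_monom
    by (intro sum.cong) (use True in auto)
  also have "\<dots> = real (n choose (n - k)) *
      (pochhammer (- \<omega>) (n - k) / pochhammer (- real n - \<omega>) (n - k))"
    by (simp add: sum.delta)
  finally show ?thesis
    using True by (simp add: binomial_symmetric[symmetric])
next
  case False
  then have "coeff (skyburst n \<omega>) k = 0"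
    unfolding skyburst_def coeff_sum coeff_monom by (intro sum.neutral) auto
  with False show ?thesis by simp
qed

text \<open>A vanishing factor -n - \<omega> + i with i < l would make \<omega> the excluded value
  -(n - i).\<close>

lemma pochhammer_skyburst_neq_0:
  assumes "\<omega> \<notin> {- real k |k. k \<le> n}" "l \<le> n"
  shows "pochhammer (- real n - \<omega>) l \<noteq> 0"
proof
  assume "pochhammer (- real n - \<omega>) l = 0"
  then obtain i where "i < l" "- real n - \<omega> = - real i"
    unfolding pochhammer_eq_0_iff by blast
  with assms(2) have "\<omega> = - real (n - i)" "n - i \<le> n"
    by (auto simp: of_nat_diff)
  with assms(1) show False by blast
qed

lemma coeff_X_mult_pderiv:
  fixes p :: "'a::{comm_semiring_1,semiring_no_zero_divisors} poly"
  shows "coeff ([:0, 1:] * pderiv p) k = of_nat k * coeff p k"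
  by (cases k) (simp_all add: coeff_pderiv coeff_pCons)

theorem lemma5:
  fixes n :: nat and \<omega> :: real
  assumes "n \<ge> 1"
    and "\<omega> \<notin> {- real k |k. k \<le> n}"
  shows "smult (\<omega> + real n) (pderiv (skyburst n \<omega>)) =
         smult (real n) ([:0, 1:] * pderiv (skyburst (n - 1) \<omega>)) +
         smult (real n * (1 + \<omega>)) (skyburst (n - 1) \<omega>)"
proof (rule poly_eqI)
  fix j
  from \<open>n \<ge> 1\<close> obtain m where n: "n = Suc m"
    by (cases n) auto
  \<comment> \<open>Differentiation lowers the degree by one, so both sides use the same Pochhammer
    length: n - (j+1) = m - j.\<close>
  define l where "l = m - j"
  define P Q where "P = pochhammer (- real n - \<omega>) l" and "Q = pochhammer (- real m - \<omega>) l"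
  have binom: "real (Suc j) * real (n choose Suc j) = real n * real (m choose j)"
    unfolding n of_nat_mult[symmetric] by (simp only: Suc_times_binomial_eq mult.commute)
  have ratio: "(\<omega> + real n) / P = (real j + 1 + \<omega>) / Q" if "j \<le> m"
  proof -
    have "P \<noteq> 0"
      unfolding P_def by (rule pochhammer_skyburst_neq_0[OF assms(2)]) (simp add: n l_def)
    moreover have "Q \<noteq> 0"
      unfolding Q_def by (rule pochhammer_skyburst_neq_0) (use assms(2) in \<open>auto simp: n l_def\<close>)
    \<comment> \<open>Both sides equal (-n-\<omega>)_(l+1), with the first or the last factor split
      off; for j \<le> m the last factor is -(j+1+\<omega>).\<close>
    moreover have "(- real n - \<omega>) * Q = (- real n - \<omega> + real l) * P"
      using pochhammer_rec[of "- real n - \<omega>" l] pochhammer_rec'[of "- real n - \<omega>" l]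
      by (simp add: P_def Q_def n)
    ultimately show ?thesis
      using that by (simp add: field_simps n l_def of_nat_diff)
  qed
  have "coeff (smult (\<omega> + real n) (pderiv (skyburst n \<omega>))) j =
      (real (Suc j) * real (n choose Suc j)) * pochhammer (- \<omega>) l * ((\<omega> + real n) / P)"
    by (simp add: coeff_pderiv coeff_skyburst n l_def P_def)
  also have "\<dots> = real n * real (m choose j) * pochhammer (- \<omega>) l * ((real j + 1 + \<omega>) / Q)"
    using ratio by (cases "j \<le> m") (simp_all only: binom, simp add: binomial_eq_0)
  also have "\<dots> = coeff (smult (real n) ([:0, 1:] * pderiv (skyburst (n - 1) \<omega>)) +
      smult (real n * (1 + \<omega>)) (skyburst (n - 1) \<omega>)) j"
    unfolding coeff_add coeff_smult coeff_X_mult_pderiv coeff_skyburst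
    by (simp add: n l_def Q_def add_divide_distrib algebra_simps)
  finally show "coeff (smult (\<omega> + real n) (pderiv (skyburst n \<omega>))) j = \<dots>" .
qed

end
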